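(* Let $n\ge1$ and let $J_{n,n}$ be the $n\times n$ real matrix all of whose entries are $1$. For an invertible matrix $G\in M_n(\mathbb{R})$, let $\mathbf{sum}(G^{-1})$ denote the sum of all entries of $G^{-1}$. Then $$\operatorname*{ap-lim}_{G\to J_{n,n}}\mathbf{sum}(G^{-1})=1,$$ where $G$ ranges over invertible matrices in $M_n(\mathbb{R})$.
   Context: $M_n(\mathbb{R})$ is identified with $\mathbb{R}^{n^2}$ with Lebesgue measure $\mathrm{vol}$ and Euclidean balls $B_r$. A measurable set $A\subset\mathbb{R}^m$ has density one at $x_0$ if $\lim_{r\to0^+}\mathrm{vol}(A\cap B_r(x_0))/\mathrm{vol}(B_r(x_0))=1$. For a measurable real-valued function $h$ defined almost everywhere near $x_0$, $\operatorname*{ap-lim}_{x\to x_0}h(x)=c$ means that for every $\varepsilon>0$ the set of $x$ in the domain of $h$ with $|h(x)-c|<\varepsilon$ has density one at $x_0$. *)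

theory Defs
  imports "HOL-Analysis.Analysis"
begin

definition density_one_at :: "'a::euclidean_space set \<Rightarrow> 'a \<Rightarrow> bool" where
  "density_one_at A x0 \<longleftrightarrow>
     A \<in> sets lebesgue \<and>
     ((\<lambda>r. measure lebesgue (A \<inter> ball x0 r) / measure lebesgue (ball x0 r)) \<longlongrightarrow> 1) (at_right 0)"

text \<open>
  Approximate limit of a partial function with domain \<open>D\<close>; the values of \<open>h\<close> outside \<open>D\<close> are
  irrelevant.  The standing requirements for the notion (\<open>h\<close> is measurable and defined almost
  everywhere near \<open>x0\<close>) are part of the definition.
\<close>

definition ap_lim :: "('a::euclidean_space \<Rightarrow> real) \<Rightarrow> 'a set \<Rightarrow> 'a \<Rightarrow> real \<Rightarrow> bool" where
  "ap_lim h D x0 c \<longleftrightarrow>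
     D \<in> sets lebesgue \<and> h \<in> borel_measurable (lebesgue_on D) \<and>
     (\<exists>r>0. negligible (ball x0 r - D)) \<and>
     (\<forall>\<epsilon>>0. density_one_at {x \<in> D. \<bar>h x - c\<bar> < \<epsilon>} x0)"

definition sum_entries :: "real ^ 'n ^ 'm \<Rightarrow> real" where
  "sum_entries A = (\<Sum>i\<in>UNIV. \<Sum>j\<in>UNIV. A $ i $ j)"

text \<open>The all-ones matrix (not the identity matrix, which is \<open>mat 1\<close>).\<close>

definition all_ones :: "real ^ 'n ^ 'm" where
  "all_ones = (\<chi> i j. 1)"

end

(*
  Let J be the all-ones matrix and sigma = sum(U^{-1}).  If w = U^{-1} 1 then
  (J + r U) w = (sigma + r) 1, so sum((J + r U)^{-1}) = sigma / (r + sigma), which tends to 1 as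
  r -> 0 whenever sigma is nonzero.  The exceptional directions U are zeros of the polynomial
  det U * (det U * sigma), which does not vanish at the identity matrix I; restricted to a line
  through I it has finitely many zeros, so by Fubini its zero set is null.  Rescaling the ball of
  radius r about J to the unit ball, dominated convergence turns convergence along almost every
  ray into density one.
*)
theory Submission
  imports Defs "HOL-Computational_Algebra.Polynomial"
begin

section \<open>Null sets along lines, and density one from rays\<close>

lemma AE_lborel_iff_negligible:
  "(AE x in lborel. P x) \<longleftrightarrow> negligible {x :: 'a::euclidean_space. \<not> P x}"
  \<comment> \<open>\<open>negligible\<close> means null for the completed measure, and completion
    does not change almost-everywhere statements.\<close>
  unfolding AE_completion_iff[symmetric, of P lborel]
  by (subst completion.AE_iff_null_sets) (simp add: negligible_iff_null_sets)

text \<open>Fubini for the map sending (x, t) to a + t x: null slices in t for every x force null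
  slices in x for almost every t. For one fixed t > 0, \<open>S\<close> is an affine image of such a
  slice, hence null.\<close>

lemma negligible_if_negligible_on_lines:
  fixes S :: "'a::euclidean_space set"
  assumes S: "S \<in> sets borel"
    and lines: "\<And>x. negligible {t :: real. a + t *\<^sub>R x \<in> S}"
  shows "negligible S"
proof -
  have meas: "{z \<in> space (lborel \<Otimes>\<^sub>M lborel). a + snd z *\<^sub>R fst z \<notin> S}
      \<in> sets (lborel \<Otimes>\<^sub>M (lborel :: real measure))"
    using S by measurable
  have "AE x in lborel. AE t :: real in lborel. a + t *\<^sub>R x \<notin> S"
    using lines by (simp add: AE_lborel_iff_negligible)
  then have "AE t :: real in lborel. AE x in lborel. a + t *\<^sub>R x \<notin> S"
    using lborel_pair.AE_commute[of "\<lambda>x t. a + t *\<^sub>R x \<notin> S"] meas by simp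
  then have neg: "negligible {t :: real. \<not> negligible {x. a + t *\<^sub>R x \<in> S}}"
    by (simp add: AE_lborel_iff_negligible)
  \<comment> \<open>An interval of positive measure avoiding 0 supplies a good t for which x
    \<mapsto> a + t x is a bijection.\<close>
  have "\<not> negligible {0 <..< 1 :: real}"
    by (intro open_not_negligible) auto
  then have "\<not> {0 <..< 1 :: real} \<subseteq> {t. \<not> negligible {x. a + t *\<^sub>R x \<in> S}}"
    using negligible_subset[OF neg] by blast
  then obtain t :: real where t: "0 < t" "negligible {x. a + t *\<^sub>R x \<in> S}"
    by auto
  have "S = (\<lambda>x. t *\<^sub>R x + a) ` {x. a + t *\<^sub>R x \<in> S}"
  proof (intro equalityI subsetI)
    fix y assume "y \<in> S"
    then show "y \<in> (\<lambda>x. t *\<^sub>R x + a) ` {x. a + t *\<^sub>R x \<in> S}"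
      using t(1) by (intro image_eqI[of _ _ "(y - a) /\<^sub>R t"]) auto
  qed (auto simp: add.commute)
  moreover have "emeasure lebesgue {x. a + t *\<^sub>R x \<in> S} = 0"
    using t(2) by (simp add: negligible_iff_null_sets null_sets_def del: emeasure_completion)
  ultimately have "emeasure lebesgue S = 0"
    by (metis emeasure_lebesgue_affine mult_zero_right)
  then show ?thesis
    using S by (simp add: negligible_iff_emeasure0 del: emeasure_completion)
qed

text \<open>The set \<open>B r\<close> below is the part of \<open>A\<close> in the ball of radius
  r, rescaled to the unit ball. Its indicator converges almost everywhere to that of the unit ball,
  which is also the dominating function.\<close>

lemma density_one_atI_AE_lines:
  fixes A :: "'a::euclidean_space set"
  assumes A: "A \<in> sets borel"
    and lines: "AE u in lborel. \<forall>\<^sub>F r in at_right 0. x0 + r *\<^sub>R u \<in> A"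
  shows "density_one_at A x0"
proof -
  define B where "B r = {u \<in> ball 0 1. x0 + r *\<^sub>R u \<in> A}" for r :: real
  have B[measurable]: "B r \<in> sets borel" for r
    unfolding B_def using A by measurable
  have int_ball: "integrable lborel (indicator (ball 0 1 :: 'a set) :: 'a \<Rightarrow> real)"
    using emeasure_lborel_ball_finite[of "0::'a" 1] by (intro integrable_real_indicator) auto
  have lim: "((\<lambda>r. measure lebesgue (B r)) \<longlongrightarrow> measure lebesgue (ball (0::'a) 1)) (at_right 0)"
    \<comment> \<open>Dominated convergence is available for sequences, so the limit is tested along
      sequences of positive reals tending to 0.\<close>
    unfolding tendsto_at_iff_sequentially
  proof (intro allI impI)
    fix X :: "nat \<Rightarrow> real"
    assume X: "\<forall>i. X i \<in> {0<..} - {0}" "X \<longlonglongrightarrow> 0"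
    then have F: "filterlim X (at_right 0) sequentially"
      by (auto simp: filterlim_at order_less_imp_not_eq2)
    have "AE u in lborel. (\<lambda>i. indicator (B (X i)) u :: real) \<longlonglongrightarrow> indicator (ball 0 1) u"
      using lines
    proof (rule eventually_mono)
      fix u assume "\<forall>\<^sub>F r in at_right 0. x0 + r *\<^sub>R u \<in> A"
      then have "\<forall>\<^sub>F i in sequentially. x0 + X i *\<^sub>R u \<in> A"
        by (rule eventually_compose_filterlim[OF _ F])
      then show "(\<lambda>i. indicator (B (X i)) u :: real) \<longlonglongrightarrow> indicator (ball 0 1) u"
        by (intro tendsto_eventually) (auto simp: B_def indicator_def elim: eventually_mono)
    qed
    moreover have "B (X i) \<in> sets lborel" for i
      using B by simp
    ultimately have "(\<lambda>i. integral\<^sup>L lborel (indicator (B (X i)) :: 'a \<Rightarrow> real))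
        \<longlonglongrightarrow> integral\<^sup>L lborel (indicator (ball 0 1) :: 'a \<Rightarrow> real)"
      by (intro integral_dominated_convergence[where w = "indicator (ball 0 1)"] int_ball
          borel_measurable_indicator) (auto simp: B_def indicator_def)
    then show "((\<lambda>r. measure lebesgue (B r)) \<circ> X) \<longlonglongrightarrow> measure lebesgue (ball (0::'a) 1)"
      by (simp add: o_def)
  qed
  have pos: "measure lebesgue (ball (0::'a) 1) > 0"
    using content_ball_pos[of 1 "0::'a"] by simp
  \<comment> \<open>The same affine map carries \<open>B r\<close> and the unit ball to the two sets
    on the left, so the power of r cancels in the quotient.\<close>
  have ratio: "measure lebesgue (A \<inter> ball x0 r) / measure lebesgue (ball x0 r)
      = measure lebesgue (B r) / measure lebesgue (ball (0::'a) 1)" if "r > 0" for r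
  proof -
    have "(\<lambda>u. r *\<^sub>R u + x0) ` ball 0 1 = (+) x0 ` (\<lambda>u. r *\<^sub>R u) ` ball 0 1"
      by (simp add: image_image add.commute)
    also have "\<dots> = ball x0 r"
      using that ball_scale[of r "0::'a" 1] by (simp add: image_add_ball)
    finally have ball: "ball x0 r = (\<lambda>u. r *\<^sub>R u + x0) ` ball 0 1" ..
    moreover have "A \<inter> ball x0 r = (\<lambda>u. r *\<^sub>R u + x0) ` B r"
      unfolding ball B_def by (auto simp: add.commute)
    ultimately show ?thesis
      using that by (simp only: measure_lebesgue_affine) simp
  qed
  have "((\<lambda>r. measure lebesgue (B r) / measure lebesgue (ball (0::'a) 1)) \<longlongrightarrow> 1) (at_right 0)"
    using tendsto_divide[OF lim tendsto_const[of "measure lebesgue (ball (0::'a) 1)"]] pos by simp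
  then have "((\<lambda>r. measure lebesgue (A \<inter> ball x0 r) / measure lebesgue (ball x0 r)) \<longlongrightarrow> 1)
      (at_right 0)"
    by (rule Lim_transform_eventually)
      (use ratio in \<open>simp add: eventually_mono[OF eventually_at_right_less[of 0]]\<close>)
  then show ?thesis
    using A by (simp add: density_one_at_def)
qed

section \<open>Determinants, cofactor sums and the matrix inverse\<close>

lemma poly_det: "poly (det P) t = det (\<chi> i j. poly (P $ i $ j) t)"
  by (simp add: det_def poly_sum poly_prod)

lemma continuous_on_det [continuous_intros]:
  fixes M :: "'a::topological_space \<Rightarrow> real ^ 'n ^ 'n"
  assumes "\<And>i j. continuous_on S (\<lambda>x. M x $ i $ j)"
  shows "continuous_on S (\<lambda>x. det (M x))"
  unfolding det_def by (intro continuous_intros assms)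

text \<open>The sum of the entries of the adjugate, in the form in which Cramer's rule delivers it.\<close>

definition sum_cofactors :: "real ^ 'n ^ 'n \<Rightarrow> real" where
  "sum_cofactors G = (\<Sum>k\<in>UNIV. det (\<chi> i j. if j = k then 1 else G $ i $ j))"

lemma continuous_on_if_const:
  "continuous_on S f \<Longrightarrow> continuous_on S g \<Longrightarrow> continuous_on S (\<lambda>x. if b then f x else g x)"
  by (cases b) simp_all

lemma continuous_on_sum_cofactors: "continuous_on S sum_cofactors"
  unfolding sum_cofactors_def
  by (intro continuous_intros) (auto intro!: continuous_on_if_const continuous_intros)

lemma sum_entries_matrix_vector: "sum_entries M = (\<Sum>i\<in>UNIV. (M *v 1) $ i)"
  by (simp add: sum_entries_def matrix_vector_mult_def)

lemma
  fixes G :: "real ^ 'n ^ 'n"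
  assumes "invertible G"
  shows matrix_inv_right: "G ** matrix_inv G = mat 1"
    and matrix_inv_left: "matrix_inv G ** G = mat 1"
  using someI_ex[OF assms[unfolded invertible_def]] by (auto simp: matrix_inv_def)

lemma matrix_inv_mult_vector_eq:
  fixes G :: "real ^ 'n ^ 'n"
  assumes "invertible G" "G *v x = b"
  shows "matrix_inv G *v b = x"
  using assms by (auto simp: matrix_vector_mul_assoc matrix_inv_left)

lemma mult_matrix_inv_vector:
  fixes G :: "real ^ 'n ^ 'n"
  assumes "invertible G"
  shows "G *v (matrix_inv G *v b) = b"
  using assms by (simp add: matrix_vector_mul_assoc matrix_inv_right)

text \<open>Cramer's rule for G x = 1, summed over the coordinates of x. This exhibits the sum as a
  rational function of the entries, from which continuity and the polynomial form of the exceptional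
  set follow.\<close>

lemma sum_entries_matrix_inv_eq_cofactors:
  fixes G :: "real ^ 'n ^ 'n"
  assumes "invertible G"
  shows "sum_entries (matrix_inv G) = sum_cofactors G / det G"
proof -
  have "matrix_inv G *v 1 = (\<chi> k. det (\<chi> i j. if j = k then 1 $ i else G $ i $ j) / det G)"
    using assms mult_matrix_inv_vector[of G 1] by (subst cramer[symmetric]) (auto simp: invertible_det_nz)
  then show ?thesis
    by (simp add: sum_entries_matrix_vector sum_cofactors_def sum_divide_distrib cong: if_cong)
qed

section \<open>Rays from the all-ones matrix and their exceptional directions\<close>

lemma all_ones_mult_vector: "all_ones *v x = (\<chi> i. \<Sum>j\<in>UNIV. x $ j)"
  by (simp add: all_ones_def matrix_vector_mult_def)

lemma
  fixes U :: "real ^ 'n ^ 'n"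
  assumes U: "invertible U" and r: "r \<noteq> 0" and nz: "r + sum_entries (matrix_inv U) \<noteq> 0"
  shows invertible_all_ones_plus: "invertible (all_ones + r *\<^sub>R U)"
    and sum_entries_inv_all_ones_plus: "sum_entries (matrix_inv (all_ones + r *\<^sub>R U)) =
      sum_entries (matrix_inv U) / (r + sum_entries (matrix_inv U))"
proof -
  define w where "w = matrix_inv U *v 1"
  define \<sigma> where "\<sigma> = sum_entries (matrix_inv U)"
  have w: "U *v w = 1" "(\<Sum>i\<in>UNIV. w $ i) = \<sigma>"
    using U by (auto simp: w_def \<sigma>_def mult_matrix_inv_vector sum_entries_matrix_vector)
  have mult: "(all_ones + r *\<^sub>R U) *v x = (\<Sum>j\<in>UNIV. x $ j) *\<^sub>R 1 + r *\<^sub>R (U *v x)" for x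
    by (simp add: matrix_vector_mult_add_rdistrib all_ones_mult_vector vec_eq_iff
        flip: scaleR_matrix_vector_assoc)
  have "x = 0" if "(all_ones + r *\<^sub>R U) *v x = 0" for x
  proof -
    define s where "s = (\<Sum>j\<in>UNIV. x $ j)"
    \<comment> \<open>A kernel vector is thus the multiple -s/r of \<open>w\<close>. Comparing
      coordinate sums gives s (r + \<sigma>) = 0, so s = 0 and the vector vanishes.\<close>
    have "U *v x = (- s / r) *\<^sub>R 1"
      using that r unfolding mult s_def[symmetric] by (auto simp: vec_eq_iff field_simps add_eq_0_iff)
    then have x: "x = (- s / r) *\<^sub>R w"
      unfolding w_def matrix_vector_mult_scaleR[symmetric]
      by (rule matrix_inv_mult_vector_eq[OF U, symmetric])
    then have "s = (- s / r) * \<sigma>"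
      by (subst s_def, subst x)
        (simp add: sum_negf flip: w(2) sum_distrib_left sum_divide_distrib)
    then have "s * (r + \<sigma>) = 0"
      using r by (simp add: field_simps)
    then show "x = 0"
      using nz x by (simp add: \<sigma>_def)
  qed
  then show inv: "invertible (all_ones + r *\<^sub>R U)"
    by (simp add: invertible_left_inverse matrix_left_invertible_ker)
  \<comment> \<open>This factor normalises \<open>w\<close> so that its image under the perturbed
    matrix is exactly the all-ones vector.\<close>
  define c where "c = inverse (r + \<sigma>)"
  have "c * (r + \<sigma>) = 1"
    using nz by (simp add: c_def \<sigma>_def[symmetric])
  then have "c * \<sigma> + r * c = 1"
    by (simp add: algebra_simps)
  then have "(all_ones + r *\<^sub>R U) *v (c *\<^sub>R w) = 1"
    unfolding mult matrix_vector_mult_scaleR w(1)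
    by (simp add: w(2) vec_eq_iff algebra_simps flip: sum_distrib_left)
  then have "matrix_inv (all_ones + r *\<^sub>R U) *v 1 = c *\<^sub>R w"
    by (rule matrix_inv_mult_vector_eq[OF inv])
  then show "sum_entries (matrix_inv (all_ones + r *\<^sub>R U)) =
      sum_entries (matrix_inv U) / (r + sum_entries (matrix_inv U))"
    by (simp add: sum_entries_matrix_vector[of "matrix_inv (all_ones + r *\<^sub>R U)"] w
        \<sigma>_def[symmetric] c_def divide_inverse mult.commute flip: sum_distrib_right)
qed

lemma negligible_det_sum_cofactors_zero:
  "negligible {U :: real ^ 'n ^ 'n. det U * sum_cofactors U = 0}"
proof (rule negligible_if_negligible_on_lines)
  have "closed {U :: real ^ 'n ^ 'n. det U * sum_cofactors U = 0}"
    by (intro closed_Collect_eq continuous_intros continuous_on_sum_cofactors)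
  then show "{U :: real ^ 'n ^ 'n. det U * sum_cofactors U = 0} \<in> sets borel"
    by simp
next
  fix X :: "real ^ 'n ^ 'n"
  \<comment> \<open>The line through the identity in direction \<open>X\<close>, as a matrix of
    linear polynomials; determinants commute with evaluation at t.\<close>
  define L :: "real poly ^ 'n ^ 'n" where "L = (\<chi> i j. [:mat 1 $ i $ j, X $ i $ j:])"
  define p where "p = det L * (\<Sum>k\<in>UNIV. det (\<chi> i j. if j = k then 1 else L $ i $ j))"
  have p: "poly p t = det (mat 1 + t *\<^sub>R X) * sum_cofactors (mat 1 + t *\<^sub>R X)" for t
    by (simp add: p_def L_def poly_det poly_sum sum_cofactors_def plus_vec_def scaleR_vec_def
        if_distrib[of "\<lambda>q. poly q t"] cong: if_cong)
  \<comment> \<open>At t = 0 the determinant is 1 and the cofactor sum is the entry sum of the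
    identity, that is, the positive dimension; hence \<open>p\<close> is not the zero
    polynomial.\<close>
  have "sum_cofactors (mat 1 :: real ^ 'n ^ 'n) = sum_entries (matrix_inv (mat 1 :: real ^ 'n ^ 'n))"
    by (subst sum_entries_matrix_inv_eq_cofactors) (auto simp: invertible_det_nz)
  also have "matrix_inv (mat 1 :: real ^ 'n ^ 'n) = mat 1"
    using matrix_inv_right[of "mat 1 :: real ^ 'n ^ 'n"] by (simp add: invertible_det_nz)
  finally have "poly p 0 \<noteq> 0"
    by (simp add: p sum_entries_matrix_vector)
  then have "p \<noteq> 0"
    by auto
  then show "negligible {t. mat 1 + t *\<^sub>R X \<in> {U. det U * sum_cofactors U = 0}}"
    using poly_roots_finite[of p] by (intro negligible_finite) (simp add: p)
qed

theorem corollary3p3: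
  shows "ap_lim (\<lambda>G :: real ^ 'n ^ 'n. sum_entries (matrix_inv G)) {G. invertible G} all_ones 1"
proof -
  let ?D = "{G :: real ^ 'n ^ 'n. invertible G}"
  let ?f = "\<lambda>G :: real ^ 'n ^ 'n. sum_cofactors G / det G"
  have openD: "open ?D"
    unfolding invertible_det_nz by (intro open_Collect_neq continuous_intros)
  have cont: "continuous_on ?D ?f"
    by (intro continuous_intros continuous_on_sum_cofactors) (auto simp: invertible_det_nz)
  \<comment> \<open>\<open>matrix_inv\<close> is defined by choice, so continuity is transferred
    from the rational expression \<open>?f\<close>, which agrees with it on
    \<open>?D\<close>.\<close>
  have cont_inv: "continuous_on ?D (\<lambda>G. sum_entries (matrix_inv G))"
    using cont by (rule continuous_on_eq) (simp add: sum_entries_matrix_inv_eq_cofactors)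
  have null: "AE U in lborel. det U * sum_cofactors (U :: real ^ 'n ^ 'n) \<noteq> 0"
    using negligible_det_sum_cofactors_zero by (simp only: AE_lborel_iff_negligible not_not)
  have dense: "density_one_at {G \<in> ?D. \<bar>sum_entries (matrix_inv G) - 1\<bar> < \<epsilon>} all_ones"
    if "\<epsilon> > 0" for \<epsilon>
  proof (rule density_one_atI_AE_lines)
    have "open (?D \<inter> (\<lambda>G. \<bar>sum_entries (matrix_inv G) - 1\<bar>) -` {..<\<epsilon>})"
      by (intro continuous_open_preimage continuous_intros cont_inv openD)
    also have "?D \<inter> (\<lambda>G. \<bar>sum_entries (matrix_inv G) - 1\<bar>) -` {..<\<epsilon>} =
        {G \<in> ?D. \<bar>sum_entries (matrix_inv G) - 1\<bar> < \<epsilon>}"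
      by auto
    finally show "{G \<in> ?D. \<bar>sum_entries (matrix_inv G) - 1\<bar> < \<epsilon>} \<in> sets borel"
      by simp
    show "AE U in lborel. \<forall>\<^sub>F r in at_right 0.
        all_ones + r *\<^sub>R U \<in> {G \<in> ?D. \<bar>sum_entries (matrix_inv G) - 1\<bar> < \<epsilon>}"
      using null
    proof (rule eventually_mono)
      fix U :: "real ^ 'n ^ 'n"
      assume *: "det U * sum_cofactors U \<noteq> 0"
      define \<sigma> where "\<sigma> = sum_entries (matrix_inv U)"
      \<comment> \<open>The cofactor sum equals det U times \<sigma>, so a nonzero product rules out
        both singular \<open>U\<close> and \<sigma> = 0.\<close>
      have U: "invertible U" and \<sigma>: "\<sigma> \<noteq> 0"
        using * by (auto simp: \<sigma>_def invertible_det_nz sum_entries_matrix_inv_eq_cofactors)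
      have id: "((\<lambda>r. r) \<longlongrightarrow> 0) (at_right (0::real))"
        by (rule tendsto_ident_at)
      have "((\<lambda>r. \<bar>\<sigma> / (r + \<sigma>) - 1\<bar>) \<longlongrightarrow> \<bar>\<sigma> / (0 + \<sigma>) - 1\<bar>) (at_right 0)"
        using \<sigma> by (intro tendsto_intros id) auto
      then have "\<forall>\<^sub>F r in at_right 0. \<bar>\<sigma> / (r + \<sigma>) - 1\<bar> < \<epsilon>"
        using \<sigma> that by (auto dest: order_tendstoD)
      moreover have "((\<lambda>r. r + \<sigma>) \<longlongrightarrow> 0 + \<sigma>) (at_right 0)"
        by (intro tendsto_intros id)
      then have "\<forall>\<^sub>F r in at_right 0. r + \<sigma> \<noteq> 0"
        using \<sigma> by (intro tendsto_imp_eventually_ne) auto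
      moreover have "\<forall>\<^sub>F r in at_right (0::real). r > 0"
        by (rule eventually_at_right_less)
      ultimately show "\<forall>\<^sub>F r in at_right 0.
          all_ones + r *\<^sub>R U \<in> {G \<in> ?D. \<bar>sum_entries (matrix_inv G) - 1\<bar> < \<epsilon>}"
        by eventually_elim
          (use U in \<open>auto simp: \<sigma>_def invertible_all_ones_plus sum_entries_inv_all_ones_plus\<close>)
    qed
  qed
  \<comment> \<open>Singular matrices lie in the same null set as the exceptional directions; the
    radius 1 is arbitrary.\<close>
  have "negligible (ball all_ones 1 - ?D)"
    by (rule negligible_subset[OF negligible_det_sum_cofactors_zero]) (auto simp: invertible_det_nz)
  moreover have "?D \<in> sets lebesgue"
    using openD by simp
  moreover have "(\<lambda>G. sum_entries (matrix_inv G)) \<in> borel_measurable (lebesgue_on ?D)"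
    using cont_inv openD by (intro continuous_imp_measurable_on_sets_lebesgue) auto
  ultimately show ?thesis
    unfolding ap_lim_def using dense zero_less_one by blast
qed

end
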